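(* The following identities of formal power series in $z$ hold: \[\sum_{n\geq 0}\mathrm{PF}_n(q)\frac{z^{n+1}}{[n]_{q}!}=\bigl(z\,\mathrm{Exp}_{q}(-z)\bigr)^{\langle -1\rangle }\quad\text{and}\quad\sum_{n\geq 0}\mathrm{UPF}_n(q)\frac{z^{n}}{[n]_{q}!}=\frac{1}{2-\exp_q(z)},\] where $F(z)^{\langle -1\rangle}$ denotes the compositional inverse of $F(z)$.
   Context: Parking functions: $n$ cars enter a one-way street with spots $1,\dots,n$ in order; car $i$ has preferred spot $\alpha_i\in[n]=\{1,\dots,n\}$. Car $i$ drives to spot $\alpha_i$ and parks there if it is free; otherwise it parks in the next free spot after $\alpha_i$, if any. The list $\alpha=(\alpha_1,\dots,\alpha_n)\in[n]^n$ is a parking function if all cars park; $\mathrm{PF}_n$ is the set of parking functions of length $n$. A unit interval parking function of length $n$ is a parking function $\alpha\in \mathrm{PF}_n$ such that for all $i$ car $i$ parks in spot $\alpha_i$ or $\alpha_i+1$; $\mathrm{UPF}_n$ is the set of these. For a word $w$ of length $n$ in positive integers, $\mathrm{inv}(w)$ is the number of pairs $(i,j)$ with $1\le i<j\le n$ and $w_i>w_j$. For $n\ge1$ set $\mathrm{PF}_n(q)=\sum_{\alpha\in \mathrm{PF}_n}q^{\mathrm{inv}(\alpha)}$ and $\mathrm{UPF}_n(q)=\sum_{\alpha\in \mathrm{UPF}_n}q^{\mathrm{inv}(\alpha)}$, and set $\mathrm{PF}_0(q)=\mathrm{UPF}_0(q)=1$. $[n]_q=1+q+\cdots+q^{n-1}$,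 $[n]_q!=[n]_q[n-1]_q\cdots[1]_q$ (with $[0]_q!=1$), $\mathrm{Exp}_q(z)=\sum_{n\geq 0}q^{\binom{n}{2}}\frac{z^n}{[n]_q!}$ and $\exp_q(z)=\sum_{n\geq 0}\frac{z^n}{[n]_q!}$. The compositional inverse of a formal power series $P(z)$ with no constant term is the power series $Q(z)$ with $Q(P(z))=z$. *)

theory Defs
  imports
    "HOL-Computational_Algebra.Polynomial"
    "HOL-Computational_Algebra.Formal_Power_Series"
    "HOL-Computational_Algebra.Fraction_Field"
begin

text \<open>Lists are indexed from 0 in Isabelle, but the spots on the street are 1, ..., n.\<close>

definition park_spot :: "nat \<Rightarrow> nat set \<Rightarrow> nat \<Rightarrow> nat option" where
  "park_spot n occ a =
     (if \<exists>s\<in>{a..n}. s \<notin> occ then Some (LEAST s. a \<le> s \<and> s \<notin> occ) else None)"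

text \<open>A car that finds no free spot leaves the street, recorded as \<^const>\<open>None\<close>, and the
  remaining cars still try to park.\<close>

fun park_from :: "nat \<Rightarrow> nat set \<Rightarrow> nat list \<Rightarrow> nat option list" where
  "park_from n occ [] = []"
| "park_from n occ (a # as) =
     (case park_spot n occ a of
        None \<Rightarrow> None # park_from n occ as
      | Some s \<Rightarrow> Some s # park_from n (insert s occ) as)"

definition parking_outcome :: "nat list \<Rightarrow> nat option list" where
  "parking_outcome \<alpha> = park_from (length \<alpha>) {} \<alpha>"

definition PF :: "nat \<Rightarrow> nat list set" where
  "PF n = {\<alpha>. length \<alpha> = n \<and> set \<alpha> \<subseteq> {1..n} \<and> None \<notin> set (parking_outcome \<alpha>)}"

definition UPF :: "nat \<Rightarrow> nat list set" where
  "UPF n = {\<alpha> \<in> PF n. \<forall>i<n. parking_outcome \<alpha> ! i = Some (\<alpha> ! i)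
                          \<or> parking_outcome \<alpha> ! i = Some (\<alpha> ! i + 1)}"

definition inversions :: "nat list \<Rightarrow> nat" where
  "inversions w = card {(i, j). i < j \<and> j < length w \<and> w ! i > w ! j}"

text \<open>For \<open>n = 0\<close> both sets are \<open>{[]}\<close>, so the two enumerators below take the
  conventional value 1 there.\<close>

definition PF_enum :: "'a::comm_semiring_1 \<Rightarrow> nat \<Rightarrow> 'a" where
  "PF_enum q n = (\<Sum>\<alpha>\<in>PF n. q ^ inversions \<alpha>)"

definition UPF_enum :: "'a::comm_semiring_1 \<Rightarrow> nat \<Rightarrow> 'a" where
  "UPF_enum q n = (\<Sum>\<alpha>\<in>UPF n. q ^ inversions \<alpha>)"

definition q_int :: "'a::comm_semiring_1 \<Rightarrow> nat \<Rightarrow> 'a" where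
  "q_int q n = (\<Sum>k<n. q ^ k)"

definition q_fact :: "'a::comm_semiring_1 \<Rightarrow> nat \<Rightarrow> 'a" where
  "q_fact q n = (\<Prod>k=1..n. q_int q k)"

definition Exp_q :: "'a::field \<Rightarrow> 'a fps" where
  "Exp_q q = Abs_fps (\<lambda>n. q ^ (n choose 2) / q_fact q n)"

definition exp_q :: "'a::field \<Rightarrow> 'a fps" where
  "exp_q q = Abs_fps (\<lambda>n. 1 / q_fact q n)"

text \<open>The indeterminate \<open>q\<close>, as an element of the field of rational functions over the
  rationals; there all \<open>q\<close>-factorials are nonzero.\<close>

definition qvar :: "rat poly fract" where
  "qvar = Fract [:0, 1:] 1"

end

theory Submission
  imports Defs
begin

unbundle fps_syntax

text \<open>Write \<open>e = exp\<^sub>q(z)\<close>. If every letter of \<open>u\<close> is smaller than every letter of \<open>v\<close>, the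
  numbers of inversions between \<open>u\<close> and \<open>v\<close> in the shuffles of \<open>u\<close> and \<open>v\<close> are distributed
  like the \<open>q\<close>-binomial coefficient, so \<open>\<Sum> q\<^sup>i\<^sup>n\<^sup>v / [n]\<^sub>q!\<close> is multiplicative under
  shuffling (\<open>sum_inversions_shuffles\<close>). A sorted word of length \<open>k\<close> contributes \<open>1 / [k]\<^sub>q!\<close>,
  the \<open>k\<close>-th coefficient of \<open>e\<close>. Both identities come from describing a family of words by
  repeatedly splitting off a sorted word in the smallest letters as a factor of a shuffle.

  Parking functions. All cars park if and only if, for every \<open>i\<close>, at least \<open>i\<close> cars prefer a spot
  in \<open>{1..i}\<close> (\<open>PF_iff_ballot\<close>). In such a word the copies of the smallest letter form a constant
  word shuffled into an arbitrary word on the remaining letters that satisfies a shifted ballot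
  condition, with a surplus \<open>k\<close> of earlier cars. The resulting recursion in \<open>k\<close> and the number of
  letters is the one satisfied by the coefficients of the powers \<open>F\<^sup>k\<^sup>+\<^sup>1\<close> of the
  solution of \<open>F = z e(F)\<close>; for \<open>k = 0\<close> it gives \<open>PF\<^sub>n(q) / [n]\<^sub>q! = [z\<^sup>n\<^sup>+\<^sup>1] F\<close>
  (\<open>ballot_words_generating_function\<close>). Since \<open>Exp\<^sub>q(-z) exp\<^sub>q(z) = 1\<close>, that equation says that
  \<open>F\<close> is the compositional inverse of \<open>z Exp\<^sub>q(-z)\<close>.

  Unit interval parking functions. Let \<open>k\<close> be the least positive number such that exactly \<open>k\<close>
  cars prefer a spot in \<open>{1..k}\<close>. No car crosses from spot \<open>k\<close> to \<open>k + 1\<close>, so the cars preferring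
  \<open>{1..k}\<close> and the others park independently. For \<open>0 < i < k\<close> some car does cross from \<open>i\<close> to
  \<open>i + 1\<close>, which forces the first group to be the sorted word \<open>1, 1, 2, \<dots>, k - 1\<close>. So a nonempty
  unit interval parking function is uniquely a shuffle of such a block with a shifted shorter one
  (\<open>unit_words_peel_block\<close>), and the generating function \<open>U\<close> satisfies \<open>U = 1 + (e - 1) U\<close>.

  Both arguments only need the \<open>q\<close>-factorials to be invertible, so they are carried out over any
  field in which these are nonzero.\<close>

section \<open>Inversions in shuffles\<close>

lemma inversions_Nil [simp]: "inversions [] = 0"
  by (simp add: inversions_def)

lemma inversions_Cons:
  "inversions (x # w) = length (filter (\<lambda>y. y < x) w) + inversions w"
proof -
  let ?A = "{j. j < length w \<and> w ! j < x}"
  let ?B = "{(i, j). i < j \<and> j < length w \<and> w ! i > w ! j}"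
  have finA: "finite ?A" by simp
  have finB: "finite ?B"
    by (rule finite_subset[of _ "{..<length w} \<times> {..<length w}"]) auto
  have "{(i, j). i < j \<and> j < length (x # w) \<and> (x # w) ! i > (x # w) ! j}
          = (\<lambda>j. (0, Suc j)) ` ?A \<union> map_prod Suc Suc ` ?B" (is "?L = ?R")
  proof (intro equalityI subsetI)
    fix p assume "p \<in> ?L"
    then obtain i j where p: "p = (i, j)" "i < j" "j < Suc (length w)" "(x # w) ! i > (x # w) ! j"
      by auto
    from p(2) obtain j' where j: "j = Suc j'" by (cases j) auto
    show "p \<in> ?R"
    proof (cases i)
      case 0
      then show ?thesis using p j by auto
    next
      case (Suc i')
      then have "(i', j') \<in> ?B" using p j by auto
      then have "map_prod Suc Suc (i', j') \<in> map_prod Suc Suc ` ?B" by (rule imageI)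
      then show ?thesis using p j Suc by simp
    qed
  qed auto
  moreover have "card ((\<lambda>j. (0::nat, Suc j)) ` ?A) = card ?A"
    by (rule card_image) (auto simp: inj_on_def)
  moreover have "card (map_prod Suc Suc ` ?B) = card ?B"
    by (rule card_image) (auto simp: inj_on_def)
  moreover have "card ((\<lambda>j. (0, Suc j)) ` ?A \<union> map_prod Suc Suc ` ?B)
      = card ((\<lambda>j. (0::nat, Suc j)) ` ?A) + card (map_prod Suc Suc ` ?B)"
    by (rule card_Un_disjoint) (use finA finB in auto)
  ultimately show ?thesis
    by (simp add: inversions_def length_filter_conv_card)
qed

lemma inversions_sorted: "sorted u \<Longrightarrow> inversions u = 0"
  by (induction u) (simp_all add: inversions_Cons filter_empty_conv not_less)

lemma q_fact_0 [simp]: "q_fact q 0 = 1"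
  by (simp add: q_fact_def)

lemma q_fact_Suc: "q_fact q (Suc n) = q_fact q n * q_int q (Suc n)"
  by (simp add: q_fact_def)

lemma q_int_add: "q_int q (m + n) = q_int q m + q ^ m * q_int q n"
proof (induction n)
  case 0
  then show ?case by (simp add: q_int_def)
next
  case (Suc n)
  then show ?case by (simp add: q_int_def power_add algebra_simps)
qed

lemma length_filter_shuffles:
  assumes "w \<in> shuffles u v"
  shows "length (filter P w) = length (filter P u) + length (filter P v)"
proof -
  have "filter P w \<in> filter P ` shuffles u v" using assms by blast
  then show ?thesis by (simp only: filter_shuffles length_shuffles)
qed

text \<open>The number of shuffles, counted by inversions, is the \<open>q\<close>-binomial coefficient times
  \<open>q ^ (inversions u + inversions v)\<close>; clearing its denominators makes the identity valid in any
  commutative semiring. In a shuffle that starts with the head of \<open>u\<close>, that letter makes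
  inversions only with letters of \<open>u\<close>. The head of \<open>v\<close>, when it comes first, also exceeds all
  letters of \<open>u\<close>, which gives a factor \<open>q ^ length u\<close>. The two cases add up by the \<open>q\<close>-Pascal
  rule \<open>[m + n]\<^sub>q = [m]\<^sub>q + q\<^sup>m [n]\<^sub>q\<close>.\<close>

lemma sum_inversions_shuffles:
  fixes q :: "'a::comm_semiring_1"
  assumes "\<forall>x\<in>set u. \<forall>y\<in>set v. x < y"
  shows "(\<Sum>w\<in>shuffles u v. q ^ inversions w) * (q_fact q (length u) * q_fact q (length v))
       = q_fact q (length u + length v) * q ^ (inversions u + inversions v)"
  using assms
proof (induction u v rule: shuffles.induct)
  case (1 v)
  then show ?case by (simp add: mult.commute)
next
  case (2 u)
  then show ?case by (simp add: mult.commute)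
next
  case (3 x xs y ys)
  let ?m = "length xs" and ?n = "length ys"
  let ?cx = "length (filter (\<lambda>z. z < x) xs)" and ?cy = "length (filter (\<lambda>z. z < y) ys)"
  let ?G = "\<lambda>S. \<Sum>w\<in>S. q ^ inversions w"
  let ?I = "q ^ (inversions (x # xs) + inversions (y # ys))"
  have inv1: "inversions (x # w) = ?cx + inversions w" if "w \<in> shuffles xs (y # ys)" for w
  proof -
    have "filter (\<lambda>z. z < x) (y # ys) = []"
      using 3(3) by (auto simp: filter_empty_conv dest: less_asym)
    then show ?thesis by (simp add: inversions_Cons length_filter_shuffles[OF that])
  qed
  have inv2: "inversions (y # w) = Suc ?m + ?cy + inversions w" if "w \<in> shuffles (x # xs) ys" for w
  proof -
    have "filter (\<lambda>z. z < y) (x # xs) = x # xs"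
      using 3(3) by (auto intro!: filter_True)
    then show ?thesis by (simp add: inversions_Cons length_filter_shuffles[OF that])
  qed
  have "?G (shuffles (x # xs) (y # ys))
      = ?G ((#) x ` shuffles xs (y # ys)) + ?G ((#) y ` shuffles (x # xs) ys)"
    unfolding shuffles.simps by (rule sum.union_disjoint) (use 3(3) in auto)
  also have "?G ((#) x ` shuffles xs (y # ys)) = q ^ ?cx * ?G (shuffles xs (y # ys))"
    by (simp add: sum.reindex inv1 power_add sum_distrib_left)
  also have "?G ((#) y ` shuffles (x # xs) ys) = q ^ (Suc ?m + ?cy) * ?G (shuffles (x # xs) ys)"
    by (simp add: sum.reindex inv2 power_add sum_distrib_left mult.assoc)
  finally have split: "?G (shuffles (x # xs) (y # ys))
     = q ^ ?cx * ?G (shuffles xs (y # ys)) + q ^ (Suc ?m + ?cy) * ?G (shuffles (x # xs) ys)" .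
  have ih1: "?G (shuffles xs (y # ys)) * (q_fact q ?m * q_fact q (Suc ?n))
       = q_fact q (Suc (?m + ?n)) * q ^ (inversions xs + inversions (y # ys))"
    using 3(1) 3(3) by simp
  have ih2: "?G (shuffles (x # xs) ys) * (q_fact q (Suc ?m) * q_fact q ?n)
       = q_fact q (Suc (?m + ?n)) * q ^ (inversions (x # xs) + inversions ys)"
    using 3(2) 3(3) by simp
  have p1: "q ^ ?cx * q ^ (inversions xs + inversions (y # ys)) = ?I"
    by (simp only: inversions_Cons power_add ac_simps)
  have p2: "q ^ ?cy * q ^ (inversions (x # xs) + inversions ys) = ?I"
    by (simp only: inversions_Cons power_add ac_simps)
  \<comment> \<open>The common factor \<open>f\<close> and the power \<open>I\<close> come out of both summands; the remaining bracket is the \<open>q\<close>-Pascal sum.\<close>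
  have regroup: "(c1 * g1 + (p * c2) * g2) * ((fm * im) * (fn * i_n))
      = f * (im + p * i_n) * I"
    if "g1 * (fm * (fn * i_n)) = f * e1" "g2 * ((fm * im) * fn) = f * e2" "c1 * e1 = I" "c2 * e2 = I"
    for c1 g1 p c2 g2 fm im fn i_n f e1 e2 I :: 'a
  proof -
    have "(c1 * g1 + (p * c2) * g2) * ((fm * im) * (fn * i_n))
        = c1 * im * (g1 * (fm * (fn * i_n))) + p * c2 * i_n * (g2 * ((fm * im) * fn))"
      by (simp add: algebra_simps)
    also have "\<dots> = f * (im * (c1 * e1) + p * i_n * (c2 * e2))"
      unfolding that(1,2) by (simp add: algebra_simps)
    also have "\<dots> = f * (im + p * i_n) * I"
      unfolding that(3,4) by (simp add: algebra_simps)
    finally show ?thesis .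
  qed
  have "?G (shuffles (x # xs) (y # ys)) * (q_fact q (Suc ?m) * q_fact q (Suc ?n))
      = q_fact q (Suc (?m + ?n)) * (q_int q (Suc ?m) + q ^ Suc ?m * q_int q (Suc ?n)) * ?I"
    unfolding split power_add q_fact_Suc[of q ?m] q_fact_Suc[of q ?n]
    by (rule regroup[OF ih1[unfolded q_fact_Suc[of q ?n]] ih2[unfolded q_fact_Suc[of q ?m]] p1 p2,
          unfolded power_add])
  also have "q_int q (Suc ?m) + q ^ Suc ?m * q_int q (Suc ?n) = q_int q (Suc (Suc (?m + ?n)))"
    using q_int_add[of q "Suc ?m" "Suc ?n"] by simp
  also have "q_fact q (Suc (?m + ?n)) * q_int q (Suc (Suc (?m + ?n))) = q_fact q (Suc (Suc (?m + ?n)))"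
    by (rule q_fact_Suc[symmetric])
  finally show ?case by simp
qed

text \<open>Letters of \<open>u\<close> and \<open>v\<close> are separated by the threshold \<open>b\<close>, so both factors can be read off from
  the shuffle. This is what makes all the decompositions below unique.\<close>

lemma mem_shuffles_iff_filter:
  fixes b :: nat
  assumes "\<forall>x\<in>set u. x \<le> b" "\<forall>y\<in>set v. b < y"
  shows "w \<in> shuffles u v \<longleftrightarrow> filter (\<lambda>x. x \<le> b) w = u \<and> filter (\<lambda>x. b < x) w = v"
proof -
  have eq: "shuffles u v = partition (\<lambda>x. x \<le> b) -` {(u, v)}"
    by (rule inv_image_partition[symmetric]) (use assms in auto)
  show ?thesis
    unfolding eq by (simp add: o_def not_le)
qed

lemma mem_shuffles_filter:
  fixes w :: "nat list"
  shows "w \<in> shuffles (filter (\<lambda>x. x \<le> b) w) (filter (\<lambda>x. b < x) w)"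
  using mem_shuffles_iff_filter[of "filter (\<lambda>x. x \<le> b) w" b "filter (\<lambda>x. b < x) w" w] by simp

text \<open>The multiplicativity in the form used for recursions: splitting off a sorted word of small letters
  contributes its coefficient in \<open>exp\<^sub>q\<close>.\<close>

lemma sum_inversions_Union_shuffles:
  fixes q :: "'a::field" and b :: nat
  assumes nz: "\<And>n. q_fact q n \<noteq> 0"
    and u: "sorted u" "\<forall>x\<in>set u. x \<le> b"
    and T: "finite T" "\<And>v. v \<in> T \<Longrightarrow> length v = l \<and> (\<forall>y\<in>set v. b < y)"
  shows "(\<Sum>w\<in>(\<Union>v\<in>T. shuffles u v). q ^ inversions w) / q_fact q (length u + l)
       = 1 / q_fact q (length u) * ((\<Sum>v\<in>T. q ^ inversions v) / q_fact q l)"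
proof -
  have inv_u: "inversions u = 0"
    by (rule inversions_sorted[OF u(1)])
  have disj: "shuffles u v \<inter> shuffles u v' = {}" if "v \<in> T" "v' \<in> T" "v \<noteq> v'" for v v'
    using that mem_shuffles_iff_filter[OF u(2), of v] mem_shuffles_iff_filter[OF u(2), of v'] T(2)
    by auto
  have one: "(\<Sum>w\<in>shuffles u v. q ^ inversions w)
      = q_fact q (length u + l) / (q_fact q (length u) * q_fact q l) * q ^ inversions v"
    if "v \<in> T" for v
  proof -
    have "\<forall>x\<in>set u. \<forall>y\<in>set v. x < y" using T(2)[OF that] u(2) by fastforce
    from sum_inversions_shuffles[OF this, of q] show ?thesis
      using T(2)[OF that] inv_u nz by (simp add: field_simps)
  qed
  have "(\<Sum>w\<in>(\<Union>v\<in>T. shuffles u v). q ^ inversions w)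
      = (\<Sum>v\<in>T. \<Sum>w\<in>shuffles u v. q ^ inversions w)"
    using T(1) disj by (intro sum.UNION_disjoint) simp_all
  also have "\<dots> = q_fact q (length u + l) / (q_fact q (length u) * q_fact q l)
                    * (\<Sum>v\<in>T. q ^ inversions v)"
    by (simp add: one sum_distrib_left)
  finally show ?thesis using nz by (simp add: field_simps)
qed

section \<open>The q-exponentials and the functional equation of the inverse\<close>

lemma exp_q_nth: "exp_q q $ n = 1 / q_fact q n"
  by (simp add: exp_q_def)

text \<open>The coefficient of \<open>z\<^sup>n\<close> in the product is an alternating sum whose partial sums have a closed
  form: the sum up to \<open>j < n\<close> equals
  \<open>(-1)\<^sup>j q\<^bsup>j(j+1)/2\<^esup> / ([n]\<^sub>q [j]\<^sub>q! [n - 1 - j]\<^sub>q!)\<close>. At \<open>j = n - 1\<close> this is cancelled by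
  the last term. The closed form is an induction on \<open>j\<close> using
  \<open>[n]\<^sub>q - [j + 1]\<^sub>q = q\<^sup>j\<^sup>+\<^sup>1 [n - j - 1]\<^sub>q\<close>.\<close>

lemma q_exponentials_inverse:
  fixes q :: "'a::field"
  assumes nz: "\<And>n. q_fact q n \<noteq> 0"
  shows "(Exp_q q oo (- fps_X)) * exp_q q = 1"
proof -
  have nzi: "q_int q (Suc n) \<noteq> 0" for n
    using nz[of "Suc n"] by (auto simp: q_fact_Suc)
  have coeff: "(Exp_q q oo (- fps_X)) $ k = (-1) ^ k * q ^ (k choose 2) / q_fact q k" for k
    by (simp add: fps_compose_uminus' Exp_q_def)
  have partial: "(\<Sum>k\<le>j. (-1) ^ k * q ^ (k choose 2) / (q_fact q k * q_fact q (j + Suc d - k)))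
      = (-1) ^ j * q ^ (Suc j choose 2) / (q_int q (j + Suc d) * q_fact q j * q_fact q d)" for j d
  proof (induction j arbitrary: d)
    case 0
    then show ?case using nz by (simp add: q_fact_Suc mult.commute numeral_2_eq_2)
  next
    case (Suc j)
    have ch: "Suc (Suc j) choose 2 = (Suc j choose 2) + Suc j"
      by (simp add: numeral_2_eq_2)
    have qi: "q_int q (Suc j + Suc d) = q_int q (Suc j) + q ^ Suc j * q_int q (Suc d)"
      by (rule q_int_add)
    have n0: "q_int q (Suc j + Suc d) \<noteq> 0" using nzi[of "j + Suc d"] by simp
    have "(\<Sum>k\<le>Suc j. (-1) ^ k * q ^ (k choose 2) / (q_fact q k * q_fact q (Suc j + Suc d - k)))
      = (-1) ^ j * q ^ (Suc j choose 2) / (q_int q (Suc j + Suc d) * q_fact q j * q_fact q (Suc d))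
        + (-1) ^ Suc j * q ^ (Suc j choose 2) / (q_fact q (Suc j) * q_fact q (Suc d))"
      using Suc.IH[of "Suc d"] by simp
    also have "\<dots> = (-1) ^ j * q ^ (Suc j choose 2) * (q_int q (Suc j) - q_int q (Suc j + Suc d))
        / (q_int q (Suc j + Suc d) * q_fact q (Suc j) * q_fact q (Suc d))"
      using nz[of j] nz[of d] nzi[of j] nzi[of d] n0
      by (simp add: q_fact_Suc field_simps)
    also have "q_int q (Suc j) - q_int q (Suc j + Suc d) = - (q ^ Suc j * q_int q (Suc d))"
      unfolding qi by simp
    also have "(-1) ^ j * q ^ (Suc j choose 2) * (- (q ^ Suc j * q_int q (Suc d)))
        / (q_int q (Suc j + Suc d) * q_fact q (Suc j) * q_fact q (Suc d))
      = (-1) ^ Suc j * q ^ (Suc (Suc j) choose 2)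
        / (q_int q (Suc j + Suc d) * q_fact q (Suc j) * q_fact q d)"
      unfolding ch power_add using nzi[of d] by (simp add: q_fact_Suc[of q d])
    finally show ?case .
  qed
  show ?thesis
  proof (rule fps_ext)
    fix n
    have prod: "((Exp_q q oo (- fps_X)) * exp_q q) $ n
        = (\<Sum>k\<le>n. (-1) ^ k * q ^ (k choose 2) / (q_fact q k * q_fact q (n - k)))"
      by (simp add: fps_mult_nth coeff exp_q_nth atLeast0AtMost)
    show "((Exp_q q oo (- fps_X)) * exp_q q) $ n = 1 $ n"
    proof (cases n)
      case 0
      then show ?thesis unfolding prod by (simp add: numeral_2_eq_2)
    next
      case (Suc j)
      have "(\<Sum>k\<le>j. (-1) ^ k * q ^ (k choose 2) / (q_fact q k * q_fact q (Suc j - k)))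
          = (-1) ^ j * q ^ (Suc j choose 2) / q_fact q (Suc j)"
        using partial[of j 0] by (simp add: q_fact_Suc mult.commute)
      then show ?thesis unfolding prod unfolding Suc by simp
    qed
  qed
qed

text \<open>Composing \<open>z E\<close> with its inverse \<open>F\<close> gives \<open>F \<cdot> E(F) = z\<close>; multiplying by
  \<open>e(F) = 1 / E(F)\<close> solves this for \<open>F\<close>.\<close>

lemma fps_inv_X_mult:
  fixes E e :: "'a::field fps"
  assumes Ee: "E * e = 1"
  shows "fps_inv (fps_X * E) = fps_X * (e oo fps_inv (fps_X * E))"
proof -
  define F where "F = fps_inv (fps_X * E)"
  have E0: "E $ 0 \<noteq> 0" using Ee by (metis fps_mult_nth_0 fps_one_nth mult_zero_left zero_neq_one)
  have F0: "F $ 0 = 0" by (simp add: F_def fps_inv_def)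
  have "(fps_X * E) oo F = fps_X"
    unfolding F_def by (rule fps_inv_right) (use E0 in simp_all)
  then have X: "F * (E oo F) = fps_X"
    using F0 by (simp add: fps_compose_mult_distrib)
  have "(E oo F) * (e oo F) = 1"
    using fps_compose_mult_distrib[OF F0, of E e] Ee by simp
  then have "F = F * ((E oo F) * (e oo F))" by simp
  also have "\<dots> = fps_X * (e oo F)" using X by (simp flip: mult.assoc)
  finally show ?thesis unfolding F_def .
qed

text \<open>Since \<open>F\<^sup>k e(F)\<close> is the composition of \<open>z\<^sup>k e\<close> with \<open>F\<close>, its coefficients are sums over powers
  of \<open>F\<close>. The sum is finite because \<open>F\<close> has no constant term.\<close>

lemma fps_power_mult_compose_nth:
  fixes F e :: "'a::field fps"
  assumes "F $ 0 = 0"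
  shows "(F ^ k * (e oo F)) $ n = (\<Sum>j\<le>n. e $ j * (F ^ (k + j)) $ n)"
proof -
  have "F ^ k * (e oo F) = (fps_X ^ k * e) oo F"
    using assms by (simp add: fps_compose_mult_distrib fps_X_power_compose)
  then have "(F ^ k * (e oo F)) $ n = (\<Sum>i\<in>{0..n}. (fps_X ^ k * e) $ i * (F ^ i $ n))"
    by (simp add: fps_compose_nth)
  also have "\<dots> = (\<Sum>i\<in>{k..<k + Suc n}. e $ (i - k) * (F ^ i $ n))"
    by (rule sum.mono_neutral_cong)
       (auto simp: fps_X_power_mult_nth startsby_zero_power_prefix[OF assms])
  also have "\<dots> = (\<Sum>j\<in>{0..<Suc n}. e $ j * (F ^ (k + j)) $ n)"
    using sum.shift_bounds_nat_ivl[of "\<lambda>i. e $ (i - k) * (F ^ i $ n)" 0 k "Suc n"]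
    by (simp add: add.commute)
  finally show ?thesis by (simp add: atLeast0LessThan lessThan_Suc_atMost)
qed

section \<open>Ballot words\<close>

text \<open>The parameters are what an induction on the number of letters needs. The offset \<open>a\<close> allows the
  smallest letter to be removed without renaming the others, and \<open>k\<close> is the surplus of cars that
  come from letters removed before.\<close>

definition ballot_words :: "nat \<Rightarrow> nat \<Rightarrow> nat \<Rightarrow> nat list set" where
  "ballot_words a m k = {w. set w \<subseteq> {a<..a + m} \<and> length w + k = m
      \<and> (\<forall>i\<le>m. i \<le> k + length (filter (\<lambda>x. x \<le> a + i) w))}"

lemma finite_ballot_words: "finite (ballot_words a m k)"
  by (rule finite_subset[OF _ finite_lists_length_le[of "{a<..a + m}" m]])
     (auto simp: ballot_words_def)

lemma ballot_words_0: "ballot_words a 0 k = (if k = 0 then {[]} else {})"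
  by (auto simp: ballot_words_def)

text \<open>Removing all \<open>j\<close> copies of the smallest letter also removes one spot, so the surplus changes from
  \<open>k\<close> to \<open>k + j - 1\<close>; the ballot condition at the first spot says exactly that this is not
  negative.\<close>

lemma ballot_words_peel_smallest:
  "ballot_words a (Suc m) k =
     (\<Union>j\<in>{j. j \<le> Suc m \<and> 0 < k + j}.
        \<Union>v\<in>ballot_words (Suc a) m (k + j - 1). shuffles (replicate j (Suc a)) v)"
  (is "?L = (\<Union>j\<in>?J. ?S j)")
proof (intro equalityI subsetI)
  fix w assume w: "w \<in> ?L"
  define u where "u = filter (\<lambda>x. x \<le> Suc a) w"
  define v where "v = filter (\<lambda>x. Suc a < x) w"
  define j where "j = length u"
  have sh: "w \<in> shuffles u v"
    unfolding u_def v_def by (rule mem_shuffles_filter)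
  have "set u \<subseteq> {Suc a}"
    using w by (auto simp: u_def ballot_words_def dest: le_antisym)
  then have u: "u = replicate j (Suc a)"
    unfolding j_def by (intro replicate_eqI) auto
  have ballot: "i \<le> k + length (filter (\<lambda>x. x \<le> a + i) w)" if "i \<le> Suc m" for i
    using w that by (simp add: ballot_words_def)
  have "1 \<le> k + length (filter (\<lambda>x. x \<le> a + 1) w)"
    by (rule ballot) simp
  then have pos: "0 < k + j"
    unfolding j_def u_def Suc_eq_plus1 by linarith
  have len: "length w = j + length v"
    using length_shuffles[OF sh] by (simp add: j_def)
  have "v \<in> ballot_words (Suc a) m (k + j - 1)"
    unfolding ballot_words_def mem_Collect_eq
  proof (intro conjI allI impI)
    show "set v \<subseteq> {Suc a<..Suc a + m}" using w by (auto simp: v_def ballot_words_def)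
    have "length w + k = Suc m" using w by (simp add: ballot_words_def)
    with len pos show "length v + (k + j - 1) = m" by arith
    fix i assume "i \<le> m"
    moreover have "length (filter (\<lambda>x. x \<le> a + Suc i) w)
        = j + length (filter (\<lambda>x. x \<le> Suc a + i) v)"
      unfolding length_filter_shuffles[OF sh] u by simp
    ultimately show "i \<le> k + j - 1 + length (filter (\<lambda>x. x \<le> Suc a + i) v)"
      using ballot[of "Suc i"] pos by simp
  qed
  moreover have "j \<in> ?J" using pos len w by (simp add: ballot_words_def)
  ultimately show "w \<in> (\<Union>j\<in>?J. ?S j)" using sh u by blast
next
  fix w assume "w \<in> (\<Union>j\<in>?J. ?S j)"
  then obtain j v where j: "0 < k + j" and v: "v \<in> ballot_words (Suc a) m (k + j - 1)"
    and sh: "w \<in> shuffles (replicate j (Suc a)) v" by auto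
  show "w \<in> ?L"
    unfolding ballot_words_def mem_Collect_eq
  proof (intro conjI allI impI)
    show "set w \<subseteq> {a<..a + Suc m}"
      using v by (auto simp: set_shuffles[OF sh] ballot_words_def)
    have "length v + (k + j - 1) = m" using v by (simp add: ballot_words_def)
    with j show "length w + k = Suc m"
      unfolding length_shuffles[OF sh] length_replicate by arith
    fix i assume i: "i \<le> Suc m"
    show "i \<le> k + length (filter (\<lambda>x. x \<le> a + i) w)"
    proof (cases i)
      case (Suc i')
      then have "i' \<le> k + j - 1 + length (filter (\<lambda>x. x \<le> Suc a + i') v)"
        using v i by (simp add: ballot_words_def)
      then show ?thesis
        unfolding length_filter_shuffles[OF sh] using Suc j by simp arith
    qed simp
  qed
qed

text \<open>From \<open>F\<^sup>k\<^sup>+\<^sup>1 = z F\<^sup>k e(F)\<close> the coefficient of \<open>z\<^sup>m\<^sup>+\<^sup>2\<close> in \<open>F\<^sup>k\<^sup>+\<^sup>1\<close> is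
  \<open>\<Sum>\<^sub>j e\<^sub>j [z\<^sup>m\<^sup>+\<^sup>1] F\<^sup>k\<^sup>+\<^sup>j\<close>. This is the recursion obtained by removing the smallest letter, so
  the two sides agree by induction on \<open>m\<close>, simultaneously for all \<open>k\<close> and all offsets \<open>a\<close>.\<close>

lemma ballot_words_generating_function:
  fixes q :: "'a::field" and F :: "'a fps"
  assumes nz: "\<And>n. q_fact q n \<noteq> 0" and F: "F = fps_X * (exp_q q oo F)"
  shows "(\<Sum>w\<in>ballot_words a m k. q ^ inversions w) / q_fact q (m - k) = (F ^ Suc k) $ Suc m"
proof -
  have F0: "F $ 0 = 0" using arg_cong[OF F, of "\<lambda>f. f $ 0"] by simp
  have rec: "(F ^ Suc k) $ Suc n = (\<Sum>j\<le>n. exp_q q $ j * (F ^ (k + j)) $ n)" for k n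
  proof -
    have "F ^ Suc k = F ^ k * (fps_X * (exp_q q oo F))"
      by (simp only: power_Suc2 flip: F)
    then have "F ^ Suc k = fps_X * (F ^ k * (exp_q q oo F))"
      by (simp only: ac_simps)
    then have "(F ^ Suc k) $ Suc n = (F ^ k * (exp_q q oo F)) $ n"
      by (simp only: fps_X_mult_nth) simp
    then show ?thesis by (simp only: fps_power_mult_compose_nth[OF F0])
  qed
  show ?thesis
  proof (induction m arbitrary: a k)
    case 0
    have "(F ^ Suc k) $ Suc 0 = (if k = 0 then 1 else 0)"
      by (subst rec) (simp add: exp_q_nth F0 fps_nth_power_0)
    then show ?case by (simp add: ballot_words_0)
  next
    case (Suc m)
    let ?J = "{j. j \<le> Suc m \<and> 0 < k + j}"
    let ?S = "\<lambda>j. \<Union>v\<in>ballot_words (Suc a) m (k + j - 1). shuffles (replicate j (Suc a)) v"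
    \<comment> \<open>The number of copies of the smallest letter distinguishes the classes.\<close>
    have disj: "?S i \<inter> ?S j = {}" if "i \<noteq> j" for i j
    proof -
      have "length (filter (\<lambda>x. x \<le> Suc a) w) = j" if "w \<in> ?S j" for w j
      proof -
        from that obtain v where v: "v \<in> ballot_words (Suc a) m (k + j - 1)"
          and w: "w \<in> shuffles (replicate j (Suc a)) v" by blast
        have "filter (\<lambda>x. x \<le> Suc a) v = []"
          using v by (auto simp: ballot_words_def filter_empty_conv)
        then show ?thesis by (simp add: length_filter_shuffles[OF w])
      qed
      then show ?thesis using that by blast
    qed
    have "(\<Sum>w\<in>ballot_words a (Suc m) k. q ^ inversions w)
        = (\<Sum>j\<in>?J. \<Sum>w\<in>?S j. q ^ inversions w)"
      unfolding ballot_words_peel_smallest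
      by (rule sum.UNION_disjoint) (use disj finite_ballot_words in auto)
    then have "(\<Sum>w\<in>ballot_words a (Suc m) k. q ^ inversions w) / q_fact q (Suc m - k)
        = (\<Sum>j\<in>?J. (\<Sum>w\<in>?S j. q ^ inversions w) / q_fact q (Suc m - k))"
      by (simp add: sum_divide_distrib)
    also have "\<dots> = (\<Sum>j\<in>?J. exp_q q $ j * (F ^ (k + j)) $ Suc m)"
    proof (rule sum.cong[OF refl])
      fix j assume j: "j \<in> ?J"
      have S: "(\<Sum>w\<in>?S j. q ^ inversions w) / q_fact q (length (replicate j (Suc a)) + (m - (k + j - 1)))
        = 1 / q_fact q (length (replicate j (Suc a))) *
          ((\<Sum>v\<in>ballot_words (Suc a) m (k + j - 1). q ^ inversions v) / q_fact q (m - (k + j - 1)))"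
        by (rule sum_inversions_Union_shuffles[OF nz, where b = "Suc a"])
           (auto simp: finite_ballot_words, auto simp: ballot_words_def)
      have "(\<Sum>w\<in>?S j. q ^ inversions w) / q_fact q (Suc m - k)
        = exp_q q $ j *
          ((\<Sum>v\<in>ballot_words (Suc a) m (k + j - 1). q ^ inversions v) / q_fact q (m - (k + j - 1)))"
      proof (cases "k + j - 1 \<le> m")
        case True
        then have "j + (m - (k + j - 1)) = Suc m - k" using j by auto
        then show ?thesis using S by (simp only: exp_q_nth length_replicate)
      next
        case False
        then have "ballot_words (Suc a) m (k + j - 1) = {}" by (auto simp: ballot_words_def)
        then show ?thesis by simp
      qed
      moreover have "Suc (k + j - 1) = k + j" using j by simp
      ultimately show "(\<Sum>w\<in>?S j. q ^ inversions w) / q_fact q (Suc m - k)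
          = exp_q q $ j * (F ^ (k + j)) $ Suc m"
        by (simp only: Suc.IH)
    qed
    \<comment> \<open>The term excluded by \<open>0 < k + j\<close> belongs to \<open>F\<^sup>0\<close>, which has no coefficient at \<open>Suc m\<close>.\<close>
    also have "\<dots> = (\<Sum>j\<le>Suc m. exp_q q $ j * (F ^ (k + j)) $ Suc m)"
      by (rule sum.mono_neutral_left) auto
    also have "\<dots> = (F ^ Suc k) $ Suc (Suc m)" by (rule rec[symmetric])
    finally show ?case .
  qed
qed

section \<open>Parking functions are ballot words\<close>

lemma park_spot_eq_Some_iff:
  "park_spot n occ a = Some s \<longleftrightarrow> a \<le> s \<and> s \<le> n \<and> s \<notin> occ \<and> {a..<s} \<subseteq> occ"
proof
  assume *: "park_spot n occ a = Some s"
  then obtain t where t: "a \<le> t" "t \<le> n" "t \<notin> occ" and s: "s = (LEAST s. a \<le> s \<and> s \<notin> occ)"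
    by (auto simp: park_spot_def split: if_splits)
  have "a \<le> s \<and> s \<notin> occ" unfolding s by (rule LeastI[of _ t]) (use t in simp)
  moreover have "s \<le> t" unfolding s by (rule Least_le) (use t in simp)
  moreover have "{a..<s} \<subseteq> occ" unfolding s by (auto dest: not_less_Least)
  ultimately show "a \<le> s \<and> s \<le> n \<and> s \<notin> occ \<and> {a..<s} \<subseteq> occ" using t by auto
next
  assume *: "a \<le> s \<and> s \<le> n \<and> s \<notin> occ \<and> {a..<s} \<subseteq> occ"
  then have "(LEAST s. a \<le> s \<and> s \<notin> occ) = s"
    by (intro Least_equality) (auto simp: not_less[symmetric])
  then show "park_spot n occ a = Some s" using * by (auto simp: park_spot_def)
qed

lemma park_spot_eq_None_iff: "park_spot n occ a = None \<longleftrightarrow> {a..n} \<subseteq> occ"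
  by (auto simp: park_spot_def)

definition final_occ :: "nat \<Rightarrow> nat set \<Rightarrow> nat list \<Rightarrow> nat set" where
  "final_occ n occ w = occ \<union> {s. Some s \<in> set (park_from n occ w)}"

lemma final_occ_Nil [simp]: "final_occ n occ [] = occ"
  by (simp add: final_occ_def)

lemma final_occ_Cons:
  "final_occ n occ (a # w) =
     (case park_spot n occ a of None \<Rightarrow> final_occ n occ w | Some s \<Rightarrow> final_occ n (insert s occ) w)"
  by (auto simp: final_occ_def split: option.split)

lemma occ_subset_final_occ: "occ \<subseteq> final_occ n occ w"
  by (simp add: final_occ_def)

lemma final_occ_subset:
  "occ \<subseteq> {1..n} \<Longrightarrow> set w \<subseteq> {1..n} \<Longrightarrow> final_occ n occ w \<subseteq> {1..n}"
proof (induction w arbitrary: occ)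
  case (Cons a w)
  show ?case
  proof (cases "park_spot n occ a")
    case None
    then show ?thesis using Cons by (simp add: final_occ_Cons)
  next
    case (Some s)
    then have "1 \<le> s" "s \<le> n" using Cons.prems(2) by (auto simp: park_spot_eq_Some_iff)
    then show ?thesis using Cons Some by (simp add: final_occ_Cons)
  qed
qed simp

text \<open>Each parked car occupies a new spot, so the count of occupied spots detects whether a car was lost.\<close>

lemma card_final_occ:
  assumes "finite occ"
  shows "card (final_occ n occ w) \<le> card occ + length w \<and>
    (card (final_occ n occ w) = card occ + length w \<longleftrightarrow> None \<notin> set (park_from n occ w))"
  using assms
proof (induction w arbitrary: occ)
  case (Cons a w)
  show ?case
  proof (cases "park_spot n occ a")
    case None
    then show ?thesis using Cons.IH[OF Cons.prems] by (auto simp: final_occ_Cons)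
  next
    case (Some s)
    then have "s \<notin> occ" by (simp add: park_spot_eq_Some_iff)
    then show ?thesis using Cons.IH[of "insert s occ"] Cons.prems Some
      by (auto simp: final_occ_Cons)
  qed
qed simp

text \<open>Cars only move forward, so a car parked in \<open>{..i}\<close> prefers a spot in \<open>{..i}\<close>.\<close>

lemma card_final_occ_atMost_le:
  assumes "finite occ"
  shows "card (final_occ n occ w \<inter> {..i}) \<le> card (occ \<inter> {..i}) + length (filter (\<lambda>a. a \<le> i) w)"
  using assms
proof (induction w arbitrary: occ)
  case (Cons a w)
  show ?case
  proof (cases "park_spot n occ a")
    case None
    then show ?thesis using Cons.IH[OF Cons.prems] by (simp add: final_occ_Cons)
  next
    case (Some s)
    then have s: "s \<notin> occ" "a \<le> s" by (simp_all add: park_spot_eq_Some_iff)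
    have "card (insert s occ \<inter> {..i}) \<le> card (occ \<inter> {..i}) + (if a \<le> i then 1 else 0)"
      using s Cons.prems by (auto simp: Int_insert_left)
    then show ?thesis using Cons.IH[of "insert s occ"] Cons.prems Some
      by (simp add: final_occ_Cons split: if_splits)
  qed
qed simp

text \<open>A spot \<open>i\<close> that is free at the end was free all the time, so no car drove past it: the cars
  preferring \<open>{..i}\<close> all park there.\<close>

lemma card_final_occ_atMost_eq:
  assumes "finite occ" "i \<le> n" "i \<notin> final_occ n occ w"
  shows "card (final_occ n occ w \<inter> {..i}) = card (occ \<inter> {..i}) + length (filter (\<lambda>a. a \<le> i) w)"
  using assms
proof (induction w arbitrary: occ)
  case (Cons a w)
  have i: "i \<notin> occ" using Cons.prems(3) occ_subset_final_occ by blast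
  show ?case
  proof (cases "park_spot n occ a")
    case None
    then have "\<not> a \<le> i" using i Cons.prems(2) by (auto simp: park_spot_eq_None_iff)
    then show ?thesis using Cons None by (simp add: final_occ_Cons)
  next
    case (Some s)
    have ni: "i \<notin> final_occ n (insert s occ) w" using Cons.prems Some by (simp add: final_occ_Cons)
    then have "i \<noteq> s" using occ_subset_final_occ by blast
    moreover have s: "s \<notin> occ" "a \<le> s" "{a..<s} \<subseteq> occ"
      using Some by (simp_all add: park_spot_eq_Some_iff)
    ultimately have "s \<le> i \<longleftrightarrow> a \<le> i" using i by force
    then have "card (insert s occ \<inter> {..i}) = card (occ \<inter> {..i}) + (if a \<le> i then 1 else 0)"
      using s Cons.prems by (simp add: Int_insert_left)
    then show ?thesis using Cons.IH[of "insert s occ"] Cons.prems ni Some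
      by (simp add: final_occ_Cons)
  qed
qed simp

text \<open>If all cars park, then every spot is taken and the bound on the cars in \<open>{..i}\<close> gives the
  ballot condition. If a car is lost, then some spot \<open>i\<close> stays free, and exactly the cars
  preferring \<open>{..i}\<close> park in front of it; these are fewer than \<open>i\<close>.\<close>

lemma PF_iff_ballot:
  "w \<in> PF n \<longleftrightarrow> length w = n \<and> set w \<subseteq> {1..n} \<and> (\<forall>i\<le>n. i \<le> length (filter (\<lambda>a. a \<le> i) w))"
proof -
  have "None \<notin> set (park_from n {} w) \<longleftrightarrow> (\<forall>i\<le>n. i \<le> length (filter (\<lambda>a. a \<le> i) w))"
    if len: "length w = n" and w: "set w \<subseteq> {1..n}"
  proof -
    let ?F = "final_occ n {} w"
    have sub: "?F \<subseteq> {1..n}" by (rule final_occ_subset) (use w in simp_all)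
    have full: "None \<notin> set (park_from n {} w) \<longleftrightarrow> ?F = {1..n}"
      using card_final_occ[of "{}" n w] len sub card_subset_eq[of "{1..n}" ?F] by auto
    show ?thesis
    proof
      assume "None \<notin> set (park_from n {} w)"
      then have F: "?F = {1..n}" by (simp add: full)
      show "\<forall>i\<le>n. i \<le> length (filter (\<lambda>a. a \<le> i) w)"
      proof (intro allI impI)
        fix i assume "i \<le> n"
        then have int: "{1..n} \<inter> {..i} = {1..i}" by auto
        show "i \<le> length (filter (\<lambda>a. a \<le> i) w)"
          using card_final_occ_atMost_le[of "{}" n w i] unfolding F int by simp
      qed
    next
      assume ballot: "\<forall>i\<le>n. i \<le> length (filter (\<lambda>a. a \<le> i) w)"
      show "None \<notin> set (park_from n {} w)"
      proof (rule ccontr)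
        assume "\<not> None \<notin> set (park_from n {} w)"
        then have "\<not> {1..n} \<subseteq> ?F" using full sub by blast
        then obtain i where i: "1 \<le> i" "i \<le> n" "i \<notin> ?F" by (auto simp: subset_eq)
        have "i \<le> card (?F \<inter> {..i})"
          using ballot i card_final_occ_atMost_eq[of "{}" i n w] by simp
        also have "\<dots> \<le> card {1..<i}"
        proof (rule card_mono)
          show "?F \<inter> {..i} \<subseteq> {1..<i}"
          proof
            fix s assume "s \<in> ?F \<inter> {..i}"
            then show "s \<in> {1..<i}" using sub i(3) by (cases "s = i") auto
          qed
        qed simp
        finally show False using i(1) by simp
      qed
    qed
  qed
  then show ?thesis by (auto simp: PF_def parking_outcome_def)
qed

lemma PF_eq_ballot_words: "PF n = ballot_words 0 n 0"
proof -
  have int: "{1..n} = {0<..0 + n}" by auto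
  show ?thesis
    unfolding ballot_words_def
    by (rule set_eqI) (auto simp only: PF_iff_ballot int mem_Collect_eq add_0 add_0_right)
qed

lemma parking_generating_function:
  fixes q :: "'a::field"
  assumes nz: "\<And>n. q_fact q n \<noteq> 0"
  shows "fps_X * Abs_fps (\<lambda>n. PF_enum q n / q_fact q n) = fps_inv (fps_X * (Exp_q q oo (- fps_X)))"
proof -
  define F where "F = fps_inv (fps_X * (Exp_q q oo (- fps_X)))"
  have F: "F = fps_X * (exp_q q oo F)"
    unfolding F_def by (rule fps_inv_X_mult[OF q_exponentials_inverse[OF nz]])
  have "(fps_X * Abs_fps (\<lambda>n. PF_enum q n / q_fact q n)) $ n = F $ n" for n
  proof (cases n)
    case 0
    then show ?thesis using arg_cong[OF F, of "\<lambda>f. f $ 0"] by (simp only: fps_X_mult_nth) simp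
  next
    case (Suc m)
    have "PF_enum q m / q_fact q m = F $ Suc m"
      using ballot_words_generating_function[OF nz F, of 0 m 0]
      by (simp only: PF_enum_def PF_eq_ballot_words diff_zero power_Suc power_0 mult_1_right)
    then show ?thesis unfolding Suc by (simp only: fps_X_mult_nth fps_nth_Abs_fps) simp
  qed
  then show ?thesis unfolding F_def by (rule fps_ext)
qed

section \<open>Unit interval parking\<close>

text \<open>\<open>F\<close> is the set of free spots. Working with free instead of occupied spots, and without the length
  of the street, makes the restriction to a part of the street an intersection.\<close>

fun unit_parks :: "nat set \<Rightarrow> nat list \<Rightarrow> bool" where
  "unit_parks F [] = True"
| "unit_parks F (a # w) =
     (if a \<in> F then unit_parks (F - {a}) w else Suc a \<in> F \<and> unit_parks (F - {Suc a}) w)"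

text \<open>A lost car parks neither at its preferred spot nor next to it, so the condition on single cars
  already implies that all cars park.\<close>

lemma park_from_unit_iff:
  assumes "set w \<subseteq> {1..n}"
  shows "list_all2 (\<lambda>p a. p = Some a \<or> p = Some (a + 1)) (park_from n occ w) w
     \<longleftrightarrow> unit_parks ({1..n} - occ) w"
  using assms
proof (induction w arbitrary: occ)
  case (Cons a w)
  have a: "1 \<le> a" "a \<le> n" using Cons.prems by auto
  have ins: "{1..n} - insert s occ = {1..n} - occ - {s}" for s by auto
  have IH: "list_all2 (\<lambda>p a. p = Some a \<or> p = Some (a + 1)) (park_from n occ' w) w
     \<longleftrightarrow> unit_parks ({1..n} - occ') w" for occ'
    using Cons by simp
  show ?case
  proof (cases "park_spot n occ a")
    case None
    then have "{a..n} \<subseteq> occ" by (simp add: park_spot_eq_None_iff)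
    then have "a \<notin> {1..n} - occ" "Suc a \<notin> {1..n} - occ" using a by auto
    then show ?thesis by (simp only: park_from.simps None option.case unit_parks.simps) simp
  next
    case (Some s)
    then have s: "a \<le> s" "s \<le> n" "s \<notin> occ" "{a..<s} \<subseteq> occ"
      by (simp_all add: park_spot_eq_Some_iff)
    consider "s = a" | "s = Suc a" | "Suc a < s" using s(1) by linarith
    then show ?thesis
    proof cases
      case 1
      then show ?thesis using Some s a by (simp add: IH ins flip: One_nat_def)
    next
      case 2
      then have "a \<in> occ" using s by auto
      then show ?thesis using 2 Some s a by (simp add: IH ins flip: One_nat_def)
    next
      case 3
      then have "a \<in> occ" "Suc a \<in> occ" using s by auto
      then show ?thesis using 3 Some by simp
    qed
  qed
qed simp

lemma length_park_from: "length (park_from n occ w) = length w"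
  by (induction w arbitrary: occ) (simp_all split: option.split)

text \<open>As for ballot words, the offset \<open>a\<close> avoids renaming letters when small letters are removed.\<close>

definition unit_words :: "nat \<Rightarrow> nat \<Rightarrow> nat list set" where
  "unit_words a n = {w. length w = n \<and> set w \<subseteq> {a<..a + n} \<and> unit_parks {a<..a + n} w}"

lemma UPF_eq_unit_words: "UPF n = unit_words 0 n"
proof -
  have "w \<in> UPF n \<longleftrightarrow> w \<in> unit_words 0 n" if len: "length w = n" and w: "set w \<subseteq> {1..n}" for w
  proof -
    let ?R = "\<lambda>p a. p = Some a \<or> p = Some (a + 1)"
    have all2: "(\<forall>i<n. ?R (park_from n {} w ! i) (w ! i)) \<longleftrightarrow> list_all2 ?R (park_from n {} w) w"
      using len by (simp add: list_all2_conv_all_nth length_park_from)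
    have "None \<notin> set (park_from n {} w)" if "list_all2 ?R (park_from n {} w) w"
      using that by (auto simp: list_all2_conv_all_nth in_set_conv_nth)
    moreover have "{0<..0 + n} = {1..n}" by auto
    ultimately show ?thesis
      using len w all2 park_from_unit_iff[OF w, of "{}"]
      unfolding UPF_def PF_def unit_words_def parking_outcome_def by auto
  qed
  moreover have "{0<..0 + n} = {1..n}" by auto
  ultimately show ?thesis
    unfolding UPF_def PF_def unit_words_def by blast
qed

text \<open>Cars preferring a spot beyond \<open>b\<close> occupy distinct free spots beyond \<open>b\<close>.\<close>

lemma length_filter_greater_le:
  assumes "unit_parks F w" "finite F"
  shows "length (filter (\<lambda>x. b < x) w) \<le> card (F \<inter> {b<..})"
  using assms
proof (induction w arbitrary: F)
  case (Cons a w)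
  define s where "s = (if a \<in> F then a else Suc a)"
  have s: "s \<in> F" "a \<le> s" "unit_parks (F - {s}) w"
    using Cons.prems by (auto simp: s_def split: if_splits)
  have IH: "length (filter (\<lambda>x. b < x) w) \<le> card ((F - {s}) \<inter> {b<..})"
    using Cons.IH[OF s(3)] Cons.prems(2) by simp
  show ?case
  proof (cases "b < a")
    case True
    then have "F \<inter> {b<..} = insert s ((F - {s}) \<inter> {b<..})" using s by auto
    then show ?thesis using IH True Cons.prems(2) by simp
  next
    case False
    have "card ((F - {s}) \<inter> {b<..}) \<le> card (F \<inter> {b<..})"
      by (rule card_mono) (use Cons.prems(2) in auto)
    then show ?thesis using IH False by simp
  qed
qed simp

text \<open>Cars preferring a spot up to \<open>b\<close> occupy distinct free spots up to \<open>b + 1\<close>.\<close>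

lemma length_filter_atMost_le:
  assumes "unit_parks F w" "finite F"
  shows "length (filter (\<lambda>x. x \<le> b) w) \<le> card (F \<inter> {..Suc b})"
  using assms
proof (induction w arbitrary: F)
  case (Cons a w)
  define s where "s = (if a \<in> F then a else Suc a)"
  have s: "s \<in> F" "s \<le> Suc a" "unit_parks (F - {s}) w"
    using Cons.prems by (auto simp: s_def split: if_splits)
  have IH: "length (filter (\<lambda>x. x \<le> b) w) \<le> card ((F - {s}) \<inter> {..Suc b})"
    using Cons.IH[OF s(3)] Cons.prems(2) by simp
  show ?case
  proof (cases "a \<le> b")
    case True
    then have "F \<inter> {..Suc b} = insert s ((F - {s}) \<inter> {..Suc b})" using s by auto
    then show ?thesis using IH True Cons.prems(2) by simp
  next
    case False
    have "card ((F - {s}) \<inter> {..Suc b}) \<le> card (F \<inter> {..Suc b})"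
      by (rule card_mono) (use Cons.prems(2) in auto)
    then show ?thesis using IH False by simp
  qed
qed simp

text \<open>If the cars preferring spots beyond \<open>b\<close> are exactly as many as the free spots there, then no car
  may cross from \<open>b\<close> to \<open>b + 1\<close>, and the two parts of the street do not interact. Conversely,
  parking successfully on the part \<open>{..b}\<close> alone already excludes a crossing.\<close>

lemma unit_parks_split:
  assumes "finite F" "length (filter (\<lambda>x. b < x) w) = card (F \<inter> {b<..})"
  shows "unit_parks F w \<longleftrightarrow> unit_parks (F \<inter> {..b}) (filter (\<lambda>x. x \<le> b) w)
            \<and> unit_parks (F \<inter> {b<..}) (filter (\<lambda>x. b < x) w)"
  using assms
proof (induction w arbitrary: F)
  case (Cons a w)
  have IH: "unit_parks (F - {s}) w \<longleftrightarrow> unit_parks ((F - {s}) \<inter> {..b}) (filter (\<lambda>x. x \<le> b) w)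
            \<and> unit_parks ((F - {s}) \<inter> {b<..}) (filter (\<lambda>x. b < x) w)"
    if "length (filter (\<lambda>x. b < x) w) = card ((F - {s}) \<inter> {b<..})" for s
    by (rule Cons.IH) (use Cons.prems that in simp_all)
  have le: "(F - {s}) \<inter> {..b} = F \<inter> {..b} - {s}" and gt: "(F - {s}) \<inter> {b<..} = F \<inter> {b<..} - {s}" for s
    by auto
  consider "b < a" | "a < b" | "a = b" by linarith
  then show ?case
  proof cases
    case 1
    have len: "length (filter (\<lambda>x. b < x) w) = card (F \<inter> {b<..} - {s})" if "s \<in> F" "b < s" for s
      using Cons.prems 1 that by simp
    have eq: "F \<inter> {..b} - {s} = F \<inter> {..b}" if "b < s" for s using that by auto
    show ?thesis
      using 1 IH[of a] IH[of "Suc a"] len[of a] len[of "Suc a"]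
      by (auto simp: le gt eq)
  next
    case 2
    have eq: "F \<inter> {b<..} - {s} = F \<inter> {b<..}" if "s \<le> b" for s using that by auto
    show ?thesis
      using 2 IH[of a] IH[of "Suc a"] Cons.prems
      by (auto simp: le gt eq)
  next
    case 3
    have eq: "F \<inter> {b<..} - {b} = F \<inter> {b<..}" by auto
    \<comment> \<open>A crossing uses up a free spot beyond \<open>b\<close>, leaving too few for the cars preferring them.\<close>
    have cross: "\<not> (Suc b \<in> F \<and> unit_parks (F - {Suc b}) w)"
    proof
      assume *: "Suc b \<in> F \<and> unit_parks (F - {Suc b}) w"
      then have "length (filter (\<lambda>x. b < x) w) \<le> card (F \<inter> {b<..} - {Suc b})"
        using length_filter_greater_le[of "F - {Suc b}" w b] Cons.prems(1) by (simp add: gt)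
      moreover have "card (F \<inter> {b<..} - {Suc b}) < card (F \<inter> {b<..})"
        by (rule card_Diff1_less) (use Cons.prems(1) * in auto)
      ultimately show False using Cons.prems(2) 3 by simp
    qed
    show ?thesis
      using 3 IH[of b] Cons.prems cross
      by (auto simp: le gt eq)
  qed
qed simp

section \<open>Decomposition of unit interval parking functions into blocks\<close>

text \<open>The word \<open>a + 1, a + 1, a + 2, \<dots>, a + k - 1\<close> of length \<open>k\<close>, intended for \<open>k > 0\<close>. Its first car
  parks at its preferred spot and each later car is pushed forward by one.\<close>

definition unit_block :: "nat \<Rightarrow> nat \<Rightarrow> nat list" where
  "unit_block a k = Suc a # [Suc a..<a + k]"

lemma length_unit_block: "0 < k \<Longrightarrow> length (unit_block a k) = k"
  by (simp add: unit_block_def)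

lemma set_unit_block: "0 < k \<Longrightarrow> set (unit_block a k) \<subseteq> {a<..a + k}"
  by (auto simp: unit_block_def)

text \<open>The cars of a block after the first one: the spots up to \<open>s\<close> are taken, and each car is displaced
  by one.\<close>

lemma unit_parks_upt: "unit_parks {s<..t} [s..<t]"
proof (induction "t - s" arbitrary: s)
  case (Suc d)
  then have "s < t" by simp
  have "unit_parks {Suc s<..t} [Suc s..<t]" by (rule Suc.hyps(1)) (use Suc.hyps(2) in simp)
  moreover have "{s<..t} - {Suc s} = {Suc s<..t}" by auto
  ultimately show ?case using \<open>s < t\<close> by (simp add: upt_conv_Cons)
qed simp

lemma unit_parks_block:
  assumes "0 < k"
  shows "unit_parks {a<..a + k} (unit_block a k)"
proof -
  have "{a<..a + k} - {Suc a} = {Suc a<..a + k}" by auto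
  then show ?thesis using assms unit_parks_upt[of "Suc a" "a + k"] by (simp add: unit_block_def)
qed

text \<open>The spots up to \<open>s\<close> are taken, those in \<open>{s<..t}\<close> are free, and the hypothesis says that
  for every \<open>i\<close> in between a car will have to cross from \<open>i\<close> to \<open>i + 1\<close>. A car that parks
  directly at its preferred spot \<open>c > s\<close> blocks the crossing from \<open>c - 1\<close>. So the next car is
  displaced, and the only free spot behind a taken one is \<open>s + 1\<close>.\<close>

lemma unit_parks_prime_upt:
  assumes "unit_parks {s<..t} w" "length w = t - s"
    and "\<And>i. s \<le> i \<Longrightarrow> i < t \<Longrightarrow> i < s + length (filter (\<lambda>x. x \<le> i) w)"
  shows "w = [s..<t]"
  using assms
proof (induction w arbitrary: s)
  case (Cons c w)
  have st: "s < t" using Cons.prems(2) by simp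
  have unlucky: "c \<notin> {s<..t}"
  proof
    assume c: "c \<in> {s<..t}"
    then have "unit_parks ({s<..t} - {c}) w" using Cons.prems(1) by simp
    then have "length (filter (\<lambda>x. x \<le> c - 1) w) \<le> card (({s<..t} - {c}) \<inter> {..Suc (c - 1)})"
      by (rule length_filter_atMost_le) simp
    also have "({s<..t} - {c}) \<inter> {..Suc (c - 1)} = {s<..<c}" using c by auto
    finally have "length (filter (\<lambda>x. x \<le> c - 1) w) \<le> c - Suc s" by simp
    moreover have "c - 1 < s + length (filter (\<lambda>x. x \<le> c - 1) (c # w))"
      by (rule Cons.prems(3)) (use c in auto)
    moreover have "\<not> c \<le> c - 1" using c by auto
    ultimately show False using c by auto
  qed
  then have "Suc c \<in> {s<..t}" and rest: "unit_parks ({s<..t} - {Suc c}) w"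
    using Cons.prems(1) by auto
  with unlucky have c: "c = s" by auto
  have "{s<..t} - {Suc c} = {Suc s<..t}" using c by auto
  then have "w = [Suc s..<t]"
  proof (intro Cons.IH)
    show "length w = t - Suc s" using Cons.prems(2) by simp
    show "i < Suc s + length (filter (\<lambda>x. x \<le> i) w)" if "Suc s \<le> i" "i < t" for i
      using Cons.prems(3)[of i] that c by simp
  qed (use rest in simp)
  then show ?case using c st by (simp add: upt_conv_Cons)
qed simp

text \<open>The first car finds an empty street and parks at its preferred spot \<open>c\<close>. If \<open>c > a + 1\<close>, it blocks
  the crossing from \<open>c - 1\<close> to \<open>c\<close>; hence \<open>c = a + 1\<close>, and all later cars are displaced.\<close>

lemma unit_parks_prime_eq_block:
  assumes "unit_parks {a<..a + k} w" "length w = k" "set w \<subseteq> {a<..a + k}" "0 < k"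
    and prime: "\<And>i. 0 < i \<Longrightarrow> i < k \<Longrightarrow> i < length (filter (\<lambda>x. x \<le> a + i) w)"
  shows "w = unit_block a k"
proof -
  obtain c v where w: "w = c # v" using assms(2,4) by (cases w) auto
  have c: "a < c" "c \<le> a + k" using assms(3) w by auto
  have rest: "unit_parks ({a<..a + k} - {c}) v" using assms(1) c w by simp
  have "c = Suc a"
  proof (rule ccontr)
    assume "c \<noteq> Suc a"
    with c have c': "Suc a < c" by simp
    have "length (filter (\<lambda>x. x \<le> c - 1) v) \<le> card (({a<..a + k} - {c}) \<inter> {..Suc (c - 1)})"
      by (rule length_filter_atMost_le[OF rest]) simp
    also have "({a<..a + k} - {c}) \<inter> {..Suc (c - 1)} = {a<..<c}" using c by auto
    finally have "length (filter (\<lambda>x. x \<le> c - 1) v) \<le> c - Suc a" by simp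
    moreover have "c - 1 - a < length (filter (\<lambda>x. x \<le> a + (c - 1 - a)) w)"
      by (rule prime) (use c c' in auto)
    moreover have "a + (c - 1 - a) = c - 1" using c by simp
    moreover have "\<not> c \<le> c - 1" using c by auto
    ultimately show False using c w by simp
  qed
  moreover have "v = [Suc a..<a + k]"
  proof (rule unit_parks_prime_upt)
    have "{a<..a + k} - {Suc a} = {Suc a<..a + k}" by auto
    then show "unit_parks {Suc a<..a + k} v" using rest \<open>c = Suc a\<close> by simp
    show "length v = a + k - Suc a" using assms(2) w by simp
    show "i < Suc a + length (filter (\<lambda>x. x \<le> i) v)" if "Suc a \<le> i" "i < a + k" for i
    proof -
      have "i - a < length (filter (\<lambda>x. x \<le> a + (i - a)) w)"
        by (rule prime) (use that in auto)
      then show ?thesis using that w \<open>c = Suc a\<close> by simp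
    qed
  qed
  ultimately show ?thesis by (simp add: unit_block_def w)
qed

lemma unit_words_0: "unit_words a 0 = {[]}"
  by (auto simp: unit_words_def)

lemma finite_unit_words: "finite (unit_words a n)"
  by (rule finite_subset[OF _ finite_lists_length_eq[of "{a<..a + n}" n]])
     (auto simp: unit_words_def)

text \<open>The index \<open>k\<close> is the least positive number for which exactly \<open>k\<close> cars prefer one of the first
  \<open>k\<close> spots. At every \<open>i\<close> there are at least \<open>i\<close> such cars, so minimality means that
  the street is crossed at every \<open>0 < i < k\<close>.\<close>

lemma unit_words_peel_block:
  assumes "0 < n"
  shows "unit_words a n = (\<Union>k\<in>{1..n}. \<Union>v\<in>unit_words (a + k) (n - k). shuffles (unit_block a k) v)"
    (is "_ = (\<Union>k\<in>_. ?S k)")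
proof (intro equalityI subsetI)
  fix w assume w: "w \<in> unit_words a n"
  let ?le = "\<lambda>i. filter (\<lambda>x. x \<le> a + i) w" and ?gt = "\<lambda>i. filter (\<lambda>x. a + i < x) w"
  have len: "length w = n" and set: "set w \<subseteq> {a<..a + n}" and up: "unit_parks {a<..a + n} w"
    using w by (auto simp: unit_words_def)
  have sum: "length (?le i) + length (?gt i) = n" for i
    using length_shuffles[OF mem_shuffles_filter[of w "a + i"]] len by simp
  have full: "length (?le n) = n"
    using len set by (subst filter_True) auto
  define k where "k = (LEAST k. 0 < k \<and> length (?le k) = k)"
  have k: "0 < k" "length (?le k) = k"
    using LeastI[of "\<lambda>k. 0 < k \<and> length (?le k) = k" n] full assms by (auto simp: k_def)
  have kn: "k \<le> n"
    unfolding k_def by (rule Least_le) (use full assms in simp)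
  have ge: "i \<le> length (?le i)" if "i \<le> n" for i
  proof -
    have "{a<..a + n} \<inter> {a + i<..} = {a + i<..a + n}" by auto
    then show ?thesis
      using length_filter_greater_le[OF up, of "a + i"] sum[of i] that by simp
  qed
  have prime: "i < length (?le i)" if "0 < i" "i < k" for i
  proof -
    have "\<not> (0 < i \<and> length (?le i) = i)"
      using that(2) unfolding k_def by (rule not_less_Least)
    then show ?thesis using ge[of i] that kn by simp
  qed
  have gt_len: "length (?gt k) = n - k" using sum[of k] k kn by simp
  have int: "{a<..a + n} \<inter> {..a + k} = {a<..a + k}" "{a<..a + n} \<inter> {a + k<..} = {a + k<..a + n}"
    using kn by auto
  have "unit_parks {a<..a + k} (?le k)" "unit_parks {a + k<..a + n} (?gt k)"
    using unit_parks_split[of "{a<..a + n}" "a + k" w] up gt_len kn by (simp_all add: int)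
  note parts = this
  have "?le k = unit_block a k"
  proof (rule unit_parks_prime_eq_block[OF parts(1) k(2) _ k(1)])
    show "set (?le k) \<subseteq> {a<..a + k}" using set by auto
    fix i assume i: "0 < i" "i < k"
    have "filter (\<lambda>x. x \<le> a + i) (?le k) = ?le i"
      unfolding filter_filter by (rule filter_cong) (use i in auto)
    then show "i < length (filter (\<lambda>x. x \<le> a + i) (?le k))" using prime[OF i] by simp
  qed
  moreover have "?gt k \<in> unit_words (a + k) (n - k)"
    using gt_len parts(2) set kn by (auto simp: unit_words_def)
  ultimately have "w \<in> ?S k"
    using mem_shuffles_filter[of w "a + k"] by (intro UN_I[of "?gt k"]) simp_all
  moreover have "k \<in> {1..n}" using k(1) kn by simp
  ultimately show "w \<in> (\<Union>k\<in>{1..n}. ?S k)" by (rule UN_I[rotated])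
next
  fix w assume "w \<in> (\<Union>k\<in>{1..n}. ?S k)"
  then obtain k where "k \<in> {1..n}" "w \<in> ?S k" by blast
  then obtain v where k: "0 < k" "k \<le> n" and v: "v \<in> unit_words (a + k) (n - k)"
    and w: "w \<in> shuffles (unit_block a k) v" by auto
  have v': "length v = n - k" "set v \<subseteq> {a + k<..a + n}" "unit_parks {a + k<..a + n} v"
    using v k by (auto simp: unit_words_def)
  have "filter (\<lambda>x. x \<le> a + k) w = unit_block a k \<and> filter (\<lambda>x. a + k < x) w = v"
    using w set_unit_block[OF k(1), of a] v'(2)
    by (subst mem_shuffles_iff_filter[symmetric]) auto
  moreover have "{a<..a + n} \<inter> {..a + k} = {a<..a + k}" "{a<..a + n} \<inter> {a + k<..} = {a + k<..a + n}"
    using k by auto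
  ultimately have "unit_parks {a<..a + n} w"
    using unit_parks_split[of "{a<..a + n}" "a + k" w] v' k unit_parks_block[OF k(1), of a] by simp
  moreover have "length w = n"
    using length_shuffles[OF w] v'(1) k by (simp add: length_unit_block)
  moreover have "set w \<subseteq> {a<..a + n}"
    using set_shuffles[OF w] set_unit_block[OF k(1), of a] v'(2) k by fastforce
  ultimately show "w \<in> unit_words a n" by (simp add: unit_words_def)
qed

text \<open>The series \<open>V = 1 / (2 - exp\<^sub>q)\<close> satisfies \<open>V = 1 + (exp\<^sub>q - 1) V\<close>, whose coefficients obey the
  recursion given by removing the first block.\<close>

lemma unit_words_generating_function:
  fixes q :: "'a::field"
  assumes nz: "\<And>n. q_fact q n \<noteq> 0"
  shows "(\<Sum>w\<in>unit_words a n. q ^ inversions w) / q_fact q n = (1 / (2 - exp_q q)) $ n"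
proof -
  let ?V = "1 / (2 - exp_q q)"
  have e0: "exp_q q $ 0 = 1" by (simp add: exp_q_nth)
  have "?V * (2 - exp_q q) = 1"
    using e0 by (simp add: fps_divide_unit inverse_mult_eq_1)
  then have V: "?V = 1 + (exp_q q - 1) * ?V"
    by (simp add: algebra_simps)
  have V0: "?V $ 0 = 1"
    using arg_cong[OF V, of "\<lambda>f. f $ 0"] e0 by simp
  have rec: "?V $ n = (\<Sum>k=1..n. exp_q q $ k * ?V $ (n - k))" if "0 < n" for n
  proof -
    have "?V $ n = (\<Sum>k=0..n. (exp_q q - 1) $ k * ?V $ (n - k))"
      using arg_cong[OF V, of "\<lambda>f. f $ n"] that by (simp only: fps_add_nth fps_mult_nth) simp
    also have "\<dots> = (\<Sum>k=1..n. exp_q q $ k * ?V $ (n - k))"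
      by (rule sum.mono_neutral_cong_right) (auto simp: e0 not_less_eq_eq)
    finally show ?thesis .
  qed
  show ?thesis
  proof (induction n arbitrary: a rule: less_induct)
    case (less n)
    show ?case
    proof (cases "n = 0")
      case True
      then show ?thesis by (simp only: V0) (simp add: unit_words_0)
    next
      case False
      then have n: "0 < n" by simp
      let ?S = "\<lambda>k. \<Union>v\<in>unit_words (a + k) (n - k). shuffles (unit_block a k) v"
      \<comment> \<open>A word built from block \<open>i\<close> has \<open>i\<close> letters up to \<open>a + i\<close>; a longer block alone has \<open>i + 1\<close>.\<close>
      have disj: "?S i \<inter> ?S j = {}" if "0 < i" "i < j" for i j
      proof -
        have "filter (\<lambda>x. x \<le> a + i) w = unit_block a i" if "w \<in> ?S i" for w
        proof -
          from that obtain v where v: "v \<in> unit_words (a + i) (n - i)" "w \<in> shuffles (unit_block a i) v"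
            by blast
          have "\<forall>x\<in>set (unit_block a i). x \<le> a + i" "\<forall>y\<in>set v. a + i < y"
            using set_unit_block[OF \<open>0 < i\<close>, of a] v(1) by (auto simp: unit_words_def)
          from mem_shuffles_iff_filter[OF this, of w] v(2) show ?thesis by simp
        qed
        then have left: "length (filter (\<lambda>x. x \<le> a + i) w) = i" if "w \<in> ?S i" for w
          using that \<open>0 < i\<close> by (simp add: length_unit_block)
        have right: "i < length (filter (\<lambda>x. x \<le> a + i) w)" if "w \<in> ?S j" for w
        proof -
          from that obtain v where w: "w \<in> shuffles (unit_block a j) v" by blast
          have "[Suc a..<a + j] = [Suc a..<Suc a + i] @ [Suc a + i..<a + j]"
            using \<open>i < j\<close> upt_add_eq_append[of "Suc a" "Suc a + i" "a + j - (Suc a + i)"] by simp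
          then have "filter (\<lambda>x. x \<le> a + i) (unit_block a j) = Suc a # [Suc a..<Suc a + i]"
            using \<open>0 < i\<close> by (simp add: unit_block_def filter_empty_conv)
          then show ?thesis by (simp add: length_filter_shuffles[OF w])
        qed
        show ?thesis
        proof (rule equals0I)
          fix w assume "w \<in> ?S i \<inter> ?S j"
          then have "w \<in> ?S i" "w \<in> ?S j" by (rule IntD1, rule IntD2)
          then show False using left[of w] right[of w] by simp
        qed
      qed
      have disj': "?S i \<inter> ?S j = {}" if "0 < i" "0 < j" "i \<noteq> j" for i j
      proof (cases "i < j")
        case True
        with that(1) show ?thesis by (rule disj)
      next
        case False
        with that(3) have "j < i" by simp
        with that(2) have "?S j \<inter> ?S i = {}" by (rule disj)
        then show ?thesis by (simp only: Int_commute)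
      qed
      have "(\<Sum>w\<in>unit_words a n. q ^ inversions w) = (\<Sum>k=1..n. \<Sum>w\<in>?S k. q ^ inversions w)"
        unfolding unit_words_peel_block[OF n]
      proof (rule sum.UNION_disjoint)
        show "\<forall>k\<in>{1..n}. finite (?S k)" by (simp add: finite_unit_words)
        show "\<forall>i\<in>{1..n}. \<forall>j\<in>{1..n}. i \<noteq> j \<longrightarrow> ?S i \<inter> ?S j = {}"
        proof (intro ballI impI)
          fix i j assume "i \<in> {1..n}" "j \<in> {1..n}" "i \<noteq> j"
          then show "?S i \<inter> ?S j = {}" by (intro disj') simp_all
        qed
      qed simp
      then have "(\<Sum>w\<in>unit_words a n. q ^ inversions w) / q_fact q n
          = (\<Sum>k=1..n. (\<Sum>w\<in>?S k. q ^ inversions w) / q_fact q n)"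
        by (simp only: sum_divide_distrib)
      also have "\<dots> = (\<Sum>k=1..n. exp_q q $ k * ?V $ (n - k))"
      proof (rule sum.cong[OF refl])
        fix k assume k: "k \<in> {1..n}"
        have "(\<Sum>w\<in>?S k. q ^ inversions w) / q_fact q (length (unit_block a k) + (n - k))
          = 1 / q_fact q (length (unit_block a k)) *
            ((\<Sum>v\<in>unit_words (a + k) (n - k). q ^ inversions v) / q_fact q (n - k))"
        proof (rule sum_inversions_Union_shuffles[OF nz, where b = "a + k"])
          show "sorted (unit_block a k)" by (simp add: unit_block_def)
          show "\<forall>x\<in>set (unit_block a k). x \<le> a + k" using set_unit_block[of k a] k by auto
        qed (auto simp: finite_unit_words, auto simp: unit_words_def)
        moreover have "(\<Sum>v\<in>unit_words (a + k) (n - k). q ^ inversions v) / q_fact q (n - k) = ?V $ (n - k)"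
          by (rule less) (use k in auto)
        moreover have "length (unit_block a k) = k" "k + (n - k) = n"
          using k by (auto simp: length_unit_block)
        ultimately show "(\<Sum>w\<in>?S k. q ^ inversions w) / q_fact q n = exp_q q $ k * ?V $ (n - k)"
          by (simp only: exp_q_nth)
      qed
      also have "\<dots> = ?V $ n" using rec[of n] False by simp
      finally show ?thesis .
    qed
  qed
qed

lemma unit_parking_generating_function:
  fixes q :: "'a::field"
  assumes nz: "\<And>n. q_fact q n \<noteq> 0"
  shows "Abs_fps (\<lambda>n. UPF_enum q n / q_fact q n) = 1 / (2 - exp_q q)"
  by (rule fps_ext) (simp only: fps_nth_Abs_fps UPF_enum_def UPF_eq_unit_words unit_words_generating_function[OF nz])

section \<open>Specialization to an indeterminate q\<close>

text \<open>At \<open>q = 1\<close> the polynomial \<open>1 + q + \<cdots> + q\<^sup>m\<^sup>-\<^sup>1\<close> takes the value \<open>m\<close>, which is nonzero in the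
  rationals.\<close>

lemma q_fact_qvar_nonzero: "q_fact qvar n \<noteq> 0"
proof -
  have power: "qvar ^ k = Fract ([:0, 1:] ^ k) 1" for k
    by (induction k) (simp_all add: qvar_def One_fract_def)
  have int: "q_int qvar m = Fract (\<Sum>k<m. [:0, 1:] ^ k) 1" for m
    by (induction m) (simp_all add: q_int_def power Zero_fract_def)
  have "poly (\<Sum>k<m. [:0, 1:] ^ k) (1::rat) = of_nat m" for m
    by (simp add: poly_sum)
  then have "(\<Sum>k<m. [:0, 1::rat:] ^ k) \<noteq> 0" if "0 < m" for m
    using that by (metis poly_0 of_nat_0_eq_iff neq0_conv)
  then have "q_int qvar m \<noteq> 0" if "0 < m" for m
    using that unfolding int by (simp add: Zero_fract_def eq_fract)
  then have "q_int qvar k \<noteq> 0" if "k \<in> {1..n}" for k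
    using that by auto
  then show ?thesis unfolding q_fact_def by (meson finite_atLeastAtMost prod_zero_iff)
qed

theorem theorem1p1:
  shows "fps_X * Abs_fps (\<lambda>n. PF_enum qvar n / q_fact qvar n)
           = fps_inv (fps_X * (Exp_q qvar oo (- fps_X)))
       \<and> Abs_fps (\<lambda>n. UPF_enum qvar n / q_fact qvar n) = 1 / (2 - exp_q qvar)"
  by (intro conjI parking_generating_function unit_parking_generating_function q_fact_qvar_nonzero)

end
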